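(* Let $\mathbb{F}=\mathbb{R}$ or $\mathbb{F}=\mathbb{C}$, and let $\mathcal{H}\subset L^2(X)$ be a reproducing kernel Hilbert space as described in the context. For every phase retrievable signal $0\neq F\in\mathcal{H}$, one has $$C(F)\ \geq\ \sqrt{\mathfrak{C}_F^{-1}-1},$$ where $C(F)$ is the local stability constant of $F$ and $\mathfrak{C}_F$ is the kernel Cheeger constant of $F$.
   Context: Let $\mathbb{F}\in\{\mathbb{R},\mathbb{C}\}$, $\mathbb{T}=\{z\in\mathbb{F}:|z|=1\}$, and $a\wedge b=\min\{a,b\}$. Let $(X,\Sigma,\mu)$ be a $\sigma$-finite measure space and $L^2(X)=L^2(X,\Sigma,\mu)$ the space of $\mathbb{F}$-valued square integrable functions. Let $\mathcal{H}\subset\mathbb{F}^X$ be a reproducing kernel Hilbert space: a Hilbert space of functions $X\to\mathbb{F}$ on which every point evaluation $H\mapsto H(x)$ is bounded, so $H(x)=\langle H,k_x\rangle$ for a unique $k_x\in\mathcal{H}$. Assume that $\mathcal{H}$ embeds isometrically into $L^2(X)$; we identify $\mathcal{H}$ with its (closed) image in $L^2(X)$. The reproducing kernel $k(x,y)=\langle k_y,k_x\rangle$ is assumed measurable on $X\times X$. The operator $K:L^2(X)\to L^2(X)$, $(KG)(x)=\int_X G(y)\,k(x,y)\,d\mu(y)=\langle G,k_x\rangle$, is the orthogonal projection onto $\mathcal{H}$. For $S\in\Sigma$ let $P_SH=H\cdot\mathbf{1}_S$, $S^c=X\setminus S$, and $[K,P_S]=KP_S-P_SK$. A signal $F\in\mathcal{H}$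 is phase retrievable if whenever $G\in\mathcal{H}$ satisfies $|F|=|G|$ ($\mu$-a.e.), then $F=\alpha G$ for some $\alpha\in\mathbb{T}$. The local stability constant $C(F)\in[1,\infty]$ is the smallest constant $C>0$ such that $\inf_{\alpha\in\mathbb{T}}\|F-\alpha G\|_2\le C\,\||F|-|G|\|_2$ for all $G\in\mathcal{H}$ ($C(F)=\infty$ if no finite constant works). The kernel Cheeger constant of $0\ne F\in\mathcal{H}$ is $$\mathfrak{C}_F=\inf\left\{\frac{\|[K,P_S]F\|_2^2}{\|P_SF\|_2^2\wedge\|P_{S^c}F\|_2^2}\ :\ S\in\Sigma,\ \|P_SF\|_2>0,\ \|P_{S^c}F\|_2>0\right\}$$ if at least one such $S$ exists, and $\mathfrak{C}_F=1$ otherwise. One has $\mathfrak{C}_F\in[0,1]$. Convention: $0^{-1}=\infty$. *)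

theory Defs
  imports "HOL-Analysis.Analysis"
begin

text \<open>
  The scalar field is a set \<open>\<FF> :: complex set\<close>, either \<open>\<real>\<close> or \<open>UNIV\<close>, and \<open>X = space M\<close>.
  An \<open>\<FF>\<close>-valued function on \<open>X\<close> is represented by a total function \<open>'a \<Rightarrow> complex\<close> with values
  in \<open>\<FF>\<close> on \<open>X\<close> that vanishes outside \<open>X\<close>, so that functions on \<open>X\<close> agree iff their
  representatives are equal.
\<close>

definition fun_space :: "complex set \<Rightarrow> 'a set \<Rightarrow> ('a \<Rightarrow> complex) set" where
  "fun_space \<FF> X = {f. (\<forall>x\<in>X. f x \<in> \<FF>) \<and> (\<forall>x. x \<notin> X \<longrightarrow> f x = 0)}"

definition square_integrable :: "'a measure \<Rightarrow> ('a \<Rightarrow> complex) \<Rightarrow> bool" where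
  "square_integrable M f \<longleftrightarrow> f \<in> borel_measurable M \<and> integrable M (\<lambda>x. (cmod (f x))\<^sup>2)"

definition l2_inner :: "'a measure \<Rightarrow> ('a \<Rightarrow> complex) \<Rightarrow> ('a \<Rightarrow> complex) \<Rightarrow> complex" where
  "l2_inner M f g = (\<integral>x. f x * cnj (g x) \<partial>M)"

text \<open>Only meaningful for square integrable \<open>f\<close>: the Bochner integral of a
  non-integrable function is 0.\<close>

definition l2_norm :: "'a measure \<Rightarrow> ('a \<Rightarrow> complex) \<Rightarrow> real" where
  "l2_norm M f = sqrt (\<integral>x. (cmod (f x))\<^sup>2 \<partial>M)"

text \<open>
  A reproducing kernel Hilbert space of \<open>\<FF>\<close>-valued functions on \<open>X\<close> that embeds isometrically
  into \<open>L\<^sup>2(X)\<close>. By isometry, its inner product and norm are those of \<open>L\<^sup>2(X)\<close>. Bounded point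
  evaluations make the \<open>L\<^sup>2\<close>-seminorm a norm on \<open>H\<close> (so the distance below is a metric on \<open>H\<close>).
\<close>

definition rkhs_in_L2 :: "complex set \<Rightarrow> 'a measure \<Rightarrow> ('a \<Rightarrow> complex) set \<Rightarrow> bool" where
  "rkhs_in_L2 \<FF> M H \<longleftrightarrow>
     H \<subseteq> fun_space \<FF> (space M) \<and>
     (\<lambda>_. 0) \<in> H \<and>
     (\<forall>f\<in>H. \<forall>g\<in>H. (\<lambda>x. f x + g x) \<in> H) \<and>
     (\<forall>c\<in>\<FF>. \<forall>f\<in>H. (\<lambda>x. c * f x) \<in> H) \<and>
     (\<forall>f\<in>H. square_integrable M f) \<and>
     (\<forall>x\<in>space M. \<exists>B. \<forall>f\<in>H. cmod (f x) \<le> B * l2_norm M f) \<and>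
     Metric_space.mcomplete H (\<lambda>f g. l2_norm M (\<lambda>x. f x - g x))"

definition kernel_fun :: "'a measure \<Rightarrow> ('a \<Rightarrow> complex) set \<Rightarrow> 'a \<Rightarrow> ('a \<Rightarrow> complex)" where
  "kernel_fun M H x = (THE k. k \<in> H \<and> (\<forall>f\<in>H. f x = l2_inner M f k))"

definition rkernel :: "'a measure \<Rightarrow> ('a \<Rightarrow> complex) set \<Rightarrow> 'a \<Rightarrow> 'a \<Rightarrow> complex" where
  "rkernel M H x y = l2_inner M (kernel_fun M H y) (kernel_fun M H x)"

definition kernel_op :: "'a measure \<Rightarrow> ('a \<Rightarrow> complex) set \<Rightarrow> ('a \<Rightarrow> complex) \<Rightarrow> ('a \<Rightarrow> complex)" where
  "kernel_op M H G = (\<lambda>x. \<integral>y. G y * rkernel M H x y \<partial>M)"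

definition restr :: "'a set \<Rightarrow> ('a \<Rightarrow> complex) \<Rightarrow> ('a \<Rightarrow> complex)" where
  "restr S f = (\<lambda>x. f x * indicator S x)"

definition commutator ::
  "(('a \<Rightarrow> complex) \<Rightarrow> ('a \<Rightarrow> complex)) \<Rightarrow> (('a \<Rightarrow> complex) \<Rightarrow> ('a \<Rightarrow> complex)) \<Rightarrow>
   ('a \<Rightarrow> complex) \<Rightarrow> ('a \<Rightarrow> complex)" where
  "commutator A B f = (\<lambda>x. A (B f) x - B (A f) x)"

definition unit_scalars :: "complex set \<Rightarrow> complex set" where
  "unit_scalars \<FF> = {z \<in> \<FF>. cmod z = 1}"

definition phase_retrievable ::
  "complex set \<Rightarrow> 'a measure \<Rightarrow> ('a \<Rightarrow> complex) set \<Rightarrow> ('a \<Rightarrow> complex) \<Rightarrow> bool" where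
  "phase_retrievable \<FF> M H F \<longleftrightarrow> F \<in> H \<and>
     (\<forall>G\<in>H. (AE x in M. cmod (F x) = cmod (G x)) \<longrightarrow>
        (\<exists>\<alpha>\<in>unit_scalars \<FF>. F = (\<lambda>x. \<alpha> * G x)))"

text \<open>The infimum of the empty set in \<open>ereal\<close> is \<open>\<infinity>\<close>.\<close>

definition local_stability_constant ::
  "complex set \<Rightarrow> 'a measure \<Rightarrow> ('a \<Rightarrow> complex) set \<Rightarrow> ('a \<Rightarrow> complex) \<Rightarrow> ereal" where
  "local_stability_constant \<FF> M H F =
     Inf {ereal C | C. C > 0 \<and>
       (\<forall>G\<in>H. (INF \<alpha>\<in>unit_scalars \<FF>. l2_norm M (\<lambda>x. F x - \<alpha> * G x))
                \<le> C * l2_norm M (\<lambda>x. complex_of_real (cmod (F x) - cmod (G x))))}"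

definition separating_sets :: "'a measure \<Rightarrow> ('a \<Rightarrow> complex) \<Rightarrow> 'a set set" where
  "separating_sets M F =
     {S \<in> sets M. l2_norm M (restr S F) > 0 \<and> l2_norm M (restr (space M - S) F) > 0}"

definition kernel_cheeger_constant ::
  "'a measure \<Rightarrow> ('a \<Rightarrow> complex) set \<Rightarrow> ('a \<Rightarrow> complex) \<Rightarrow> real" where
  "kernel_cheeger_constant M H F =
     (if separating_sets M F = {} then 1
      else INF S\<in>separating_sets M F.
        (l2_norm M (commutator (kernel_op M H) (restr S) F))\<^sup>2 /
        min ((l2_norm M (restr S F))\<^sup>2) ((l2_norm M (restr (space M - S) F))\<^sup>2))"

text \<open>Square root extended by \<open>\<infinity> \<mapsto> \<infinity>\<close>. Note that \<open>inverse 0 = \<infinity>\<close> on \<open>ereal\<close>.\<close>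

definition esqrt :: "ereal \<Rightarrow> ereal" where
  "esqrt x = (if x = \<infinity> then \<infinity> else ereal (sqrt (real_of_ereal x)))"

end

theory Submission
  imports Defs
begin

text \<open>
  Given a separating set \<open>S\<close>, put \<open>A = K P\<^sub>S F\<close>, \<open>B = F - A\<close> and
  \<open>E = [K, P\<^sub>S] F = A - P\<^sub>S F\<close>, which is orthogonal to \<open>H\<close>. The competitor \<open>G = A - B\<close> differs
  from \<open>P\<^sub>S F - P\<^bsub>S\<^sup>c\<^esub> F\<close>, whose modulus is \<open>|F|\<close>, by \<open>2 E\<close>. Moreover \<open>\<langle>A, B\<rangle>\<close> is real, so that
  \<open>\<parallel>F - \<alpha> G\<parallel>\<^sup>2 = |1 - \<alpha>|\<^sup>2 \<parallel>A\<parallel>\<^sup>2 + |1 + \<alpha>|\<^sup>2 \<parallel>B\<parallel>\<^sup>2 \<ge> 4 min (\<parallel>A\<parallel>\<^sup>2) (\<parallel>B\<parallel>\<^sup>2)\<close>, and by Pythagoras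
  \<open>\<parallel>A\<parallel>\<^sup>2\<close> and \<open>\<parallel>B\<parallel>\<^sup>2\<close> are \<open>\<parallel>P\<^sub>S F\<parallel>\<^sup>2 - \<parallel>E\<parallel>\<^sup>2\<close> and \<open>\<parallel>P\<^bsub>S\<^sup>c\<^esub> F\<parallel>\<^sup>2 - \<parallel>E\<parallel>\<^sup>2\<close>.
\<close>

section \<open>Square integrable functions and their inner product\<close>

lemma square_integrable_mult_cnj:
  assumes "square_integrable M f" "square_integrable M g"
  shows "integrable M (\<lambda>x. f x * cnj (g x))"
proof (rule Bochner_Integration.integrable_bound)
  show "integrable M (\<lambda>x. (cmod (f x))\<^sup>2 + (cmod (g x))\<^sup>2)"
    using assms by (auto simp: square_integrable_def)
  have [measurable]: "f \<in> borel_measurable M" "g \<in> borel_measurable M"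
    using assms by (auto simp: square_integrable_def)
  have [measurable]: "cnj \<in> borel_measurable borel"
    by (intro borel_measurable_continuous_onI continuous_intros)
  show "(\<lambda>x. f x * cnj (g x)) \<in> borel_measurable M"
    by measurable
  have "cmod (f x) * cmod (g x) \<le> (cmod (f x))\<^sup>2 + (cmod (g x))\<^sup>2" for x
    using sum_squares_bound[of "cmod (f x)" "cmod (g x)"]
      mult_nonneg_nonneg[of "cmod (f x)" "cmod (g x)"] by (simp del: mult_nonneg_nonneg)
  then show "AE x in M. norm (f x * cnj (g x)) \<le> norm ((cmod (f x))\<^sup>2 + (cmod (g x))\<^sup>2)"
    by (simp add: norm_mult)
qed

lemma square_integrable_lincomb:
  assumes "square_integrable M f" "square_integrable M g"
  shows "square_integrable M (\<lambda>x. a * f x + b * g x)"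
  unfolding square_integrable_def
proof
  have [measurable]: "f \<in> borel_measurable M" "g \<in> borel_measurable M"
    using assms by (auto simp: square_integrable_def)
  show "(\<lambda>x. a * f x + b * g x) \<in> borel_measurable M" by measurable
  show "integrable M (\<lambda>x. (cmod (a * f x + b * g x))\<^sup>2)"
  proof (rule Bochner_Integration.integrable_bound)
    show "integrable M (\<lambda>x. 2 * (cmod a)\<^sup>2 * (cmod (f x))\<^sup>2 + 2 * (cmod b)\<^sup>2 * (cmod (g x))\<^sup>2)"
      using assms by (auto simp: square_integrable_def)
    have "(cmod (a * f x + b * g x))\<^sup>2
        \<le> 2 * (cmod a)\<^sup>2 * (cmod (f x))\<^sup>2 + 2 * (cmod b)\<^sup>2 * (cmod (g x))\<^sup>2" for x
    proof -
      have "(cmod (a * f x + b * g x))\<^sup>2 \<le> (cmod a * cmod (f x) + cmod b * cmod (g x))\<^sup>2"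
        by (intro power_mono) (metis norm_triangle_ineq norm_mult, simp)
      also have "\<dots> \<le> 2 * (cmod a * cmod (f x))\<^sup>2 + 2 * (cmod b * cmod (g x))\<^sup>2"
        using sum_squares_bound[of "cmod a * cmod (f x)" "cmod b * cmod (g x)"]
        by (simp add: power2_sum)
      finally show ?thesis by (simp add: power_mult_distrib)
    qed
    then show "AE x in M. norm ((cmod (a * f x + b * g x))\<^sup>2)
        \<le> norm (2 * (cmod a)\<^sup>2 * (cmod (f x))\<^sup>2 + 2 * (cmod b)\<^sup>2 * (cmod (g x))\<^sup>2)"
      by (intro AE_I2) (simp add: order.trans[OF _ abs_ge_self])
  qed measurable
qed

lemma square_integrable_diff:
  assumes "square_integrable M f" "square_integrable M g"
  shows "square_integrable M (\<lambda>x. f x - g x)"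
  using square_integrable_lincomb[OF assms, of 1 "-1"] by simp

lemma square_integrable_restr:
  assumes "S \<in> sets M" "square_integrable M f"
  shows "square_integrable M (restr S f)"
  unfolding square_integrable_def
proof
  have [measurable]: "f \<in> borel_measurable M" "S \<in> sets M"
    using assms by (auto simp: square_integrable_def)
  show "restr S f \<in> borel_measurable M"
    unfolding restr_def by measurable
  then have "(\<lambda>x. (cmod (restr S f x))\<^sup>2) \<in> borel_measurable M" by measurable
  moreover have "integrable M (\<lambda>x. (cmod (f x))\<^sup>2)"
    using assms by (auto simp: square_integrable_def)
  moreover have "AE x in M. norm ((cmod (restr S f x))\<^sup>2) \<le> norm ((cmod (f x))\<^sup>2)"
    by (intro AE_I2) (auto simp: restr_def indicator_def)
  ultimately show "integrable M (\<lambda>x. (cmod (restr S f x))\<^sup>2)"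
    using Bochner_Integration.integrable_bound by blast
qed

lemma l2_inner_commute: "l2_inner M g f = cnj (l2_inner M f g)"
  unfolding l2_inner_def Bochner_Integration.integral_cnj[symmetric] by (simp add: mult.commute)

lemma l2_inner_lincomb_left:
  assumes "square_integrable M f" "square_integrable M g" "square_integrable M h"
  shows "l2_inner M (\<lambda>x. a * f x + b * g x) h = a * l2_inner M f h + b * l2_inner M g h"
proof -
  have "integrable M (\<lambda>x. a * (f x * cnj (h x)))" "integrable M (\<lambda>x. b * (g x * cnj (h x)))"
    using assms by (auto intro!: square_integrable_mult_cnj)
  then show ?thesis
    unfolding l2_inner_def by (simp add: distrib_right mult.assoc)
qed

lemma l2_inner_diff_left:
  assumes "square_integrable M f" "square_integrable M g" "square_integrable M h"
  shows "l2_inner M (\<lambda>x. f x - g x) h = l2_inner M f h - l2_inner M g h"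
  using l2_inner_lincomb_left[OF assms, of 1 "-1"] by simp

lemma l2_inner_diff_right:
  assumes "square_integrable M f" "square_integrable M g" "square_integrable M h"
  shows "l2_inner M h (\<lambda>x. f x - g x) = l2_inner M h f - l2_inner M h g"
proof -
  have "l2_inner M h (\<lambda>x. f x - g x) = cnj (l2_inner M (\<lambda>x. f x - g x) h)"
    by (rule l2_inner_commute)
  also have "\<dots> = l2_inner M h f - l2_inner M h g"
    by (simp add: l2_inner_diff_left[OF assms] flip: l2_inner_commute)
  finally show ?thesis .
qed

lemma l2_norm_nonneg [simp]: "0 \<le> l2_norm M f"
  by (simp add: l2_norm_def)

lemma l2_norm_minus_commute: "l2_norm M (\<lambda>x. f x - g x) = l2_norm M (\<lambda>x. g x - f x)"
  by (simp add: l2_norm_def norm_minus_commute)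

lemma l2_inner_self: "l2_inner M f f = of_real ((l2_norm M f)\<^sup>2)"
proof -
  have "l2_inner M f f = (\<integral>x. of_real ((cmod (f x))\<^sup>2) \<partial>M)"
    unfolding l2_inner_def by (simp only: complex_norm_square)
  then show ?thesis
    by (simp only: integral_complex_of_real) (simp add: l2_norm_def)
qed

text \<open>Sesquilinear expansion, the two mixed terms being conjugate to each other. This one
  identity later serves the Cauchy-Schwarz quadratic, the midpoint computation, Pythagoras and the
  competitor estimate.\<close>

lemma l2_norm_sq_lincomb:
  assumes "square_integrable M f" "square_integrable M g"
  shows "(l2_norm M (\<lambda>x. a * f x + b * g x))\<^sup>2
    = (cmod a)\<^sup>2 * (l2_norm M f)\<^sup>2 + 2 * Re (a * cnj b * l2_inner M f g) + (cmod b)\<^sup>2 * (l2_norm M g)\<^sup>2"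
proof -
  let ?h = "\<lambda>x. a * f x + b * g x"
  have h: "square_integrable M ?h" by (rule square_integrable_lincomb[OF assms])
  have right: "l2_inner M u ?h = cnj a * l2_inner M u f + cnj b * l2_inner M u g"
    if "square_integrable M u" for u
    unfolding l2_inner_commute[of M u ?h] l2_inner_lincomb_left[OF assms that]
    by (simp flip: l2_inner_commute)
  have "of_real ((l2_norm M ?h)\<^sup>2) = l2_inner M ?h ?h" by (simp add: l2_inner_self)
  also have "\<dots> = a * cnj a * l2_inner M f f + b * cnj b * l2_inner M g g
      + (a * cnj b * l2_inner M f g + cnj (a * cnj b * l2_inner M f g))"
    using assms h by (simp add: l2_inner_lincomb_left right l2_inner_commute[of M g f] algebra_simps)
  also have "\<dots> = of_real ((cmod a)\<^sup>2 * (l2_norm M f)\<^sup>2 + (cmod b)\<^sup>2 * (l2_norm M g)\<^sup>2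
      + 2 * Re (a * cnj b * l2_inner M f g))"
    unfolding complex_add_cnj l2_inner_self by (simp only: of_real_add of_real_mult complex_norm_square)
  finally have "(l2_norm M ?h)\<^sup>2 = (cmod a)\<^sup>2 * (l2_norm M f)\<^sup>2 + (cmod b)\<^sup>2 * (l2_norm M g)\<^sup>2
      + 2 * Re (a * cnj b * l2_inner M f g)"
    by (simp only: of_real_eq_iff)
  then show ?thesis by simp
qed

section \<open>Cauchy-Schwarz and the triangle inequality\<close>

text \<open>For \<open>a > 0\<close> this is the discriminant inequality, read off at the minimizer
  \<open>- b / a\<close>. The degenerate case \<open>a = 0\<close> matters because \<open>a\<close>
  will be a squared norm that may vanish. The lemma yields both Cauchy-Schwarz and the variational
  inequality for almost minimizers.\<close>

lemma linear_coeff_bound: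
  fixes a b c :: real
  assumes "\<And>t. 0 \<le> a * t\<^sup>2 + 2 * b * t + c"
  shows "b\<^sup>2 \<le> a * c"
proof -
  have c: "0 \<le> c" using assms[of 0] by simp
  consider "a > 0" | "a = 0" | "a < 0" by linarith
  then show ?thesis
  proof cases
    case 1
    have "a * (- b / a)\<^sup>2 + 2 * b * (- b / a) + c = (a * c - b\<^sup>2) / a"
      using 1 by (simp add: field_simps power2_eq_square)
    then show ?thesis using assms[of "- b / a"] 1 by (simp add: zero_le_divide_iff)
  next
    case 2
    have "b = 0"
    proof (rule ccontr)
      assume "b \<noteq> 0"
      \<comment> \<open>At this point the affine function \<open>2 * b * t + c\<close> takes the
        value \<open>-1\<close>.\<close>
      then show False using assms[of "- (c + 1) / (2 * b)"] 2 by simp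
    qed
    then show ?thesis using 2 by simp
  next
    case 3
    \<comment> \<open>Chosen so that \<open>t \<ge> 1\<close> and
      \<open>a * t = a - 2 * \<bar>b\<bar> - c\<close>; the leading term then outweighs the other
      two and the quadratic is negative.\<close>
    define t where "t = 1 + (2 * \<bar>b\<bar> + c) / (- a)"
    have t: "1 \<le> t" using 3 c by (simp add: t_def divide_nonneg_neg)
    have at: "a * t = a - 2 * \<bar>b\<bar> - c" using 3 by (simp add: t_def field_simps)
    have "a * t\<^sup>2 + 2 * b * t + c = (a - 2 * \<bar>b\<bar> - c) * t + 2 * b * t + c"
      using at by (simp add: power2_eq_square)
    also have "\<dots> = a * t + 2 * (b - \<bar>b\<bar>) * t - c * (t - 1)" by (simp add: algebra_simps)
    also have "\<dots> < 0"
    proof -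
      have "a * t < 0" using 3 t by (simp add: mult_neg_pos)
      moreover have "2 * (b - \<bar>b\<bar>) * t \<le> 0" using t by (simp add: mult_nonpos_nonneg)
      moreover have "0 \<le> c * (t - 1)" using t c by simp
      ultimately show ?thesis by linarith
    qed
    finally show ?thesis using assms[of t] by simp
  qed
qed

text \<open>The squared norm of \<open>t * f + g\<close> is a nonnegative quadratic in the real
  variable \<open>t\<close>. The bound on the real part is enough for the triangle inequality and
  for the boundedness of functionals.\<close>

lemma Re_l2_inner_bound:
  assumes "square_integrable M f" "square_integrable M g"
  shows "\<bar>Re (l2_inner M f g)\<bar> \<le> l2_norm M f * l2_norm M g"
proof -
  have "0 \<le> (l2_norm M f)\<^sup>2 * t\<^sup>2 + 2 * Re (l2_inner M f g) * t + (l2_norm M g)\<^sup>2" for t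
  proof -
    have "0 \<le> (l2_norm M (\<lambda>x. of_real t * f x + 1 * g x))\<^sup>2" by simp
    then show ?thesis unfolding l2_norm_sq_lincomb[OF assms] by (simp add: algebra_simps)
  qed
  then have "(Re (l2_inner M f g))\<^sup>2 \<le> (l2_norm M f * l2_norm M g)\<^sup>2"
    using linear_coeff_bound by (metis power_mult_distrib)
  then show ?thesis by (rule abs_le_square_iff[THEN iffD2, THEN order_trans]) simp
qed

lemma l2_norm_triangle:
  assumes "square_integrable M f" "square_integrable M g" "square_integrable M h"
  shows "l2_norm M (\<lambda>x. f x - h x) \<le> l2_norm M (\<lambda>x. f x - g x) + l2_norm M (\<lambda>x. g x - h x)"
proof (rule power2_le_imp_le)
  let ?u = "\<lambda>x. f x - g x" and ?v = "\<lambda>x. g x - h x"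
  have uv: "square_integrable M ?u" "square_integrable M ?v"
    using assms by (auto intro: square_integrable_diff)
  have "(l2_norm M (\<lambda>x. f x - h x))\<^sup>2 = (l2_norm M (\<lambda>x. 1 * ?u x + 1 * ?v x))\<^sup>2" by simp
  also have "\<dots> = (l2_norm M ?u)\<^sup>2 + 2 * Re (l2_inner M ?u ?v) + (l2_norm M ?v)\<^sup>2"
    unfolding l2_norm_sq_lincomb[OF uv] by simp
  also have "\<dots> \<le> (l2_norm M ?u + l2_norm M ?v)\<^sup>2"
    using Re_l2_inner_bound[OF uv] by (simp add: power2_sum)
  finally show "(l2_norm M (\<lambda>x. f x - h x))\<^sup>2 \<le> (l2_norm M ?u + l2_norm M ?v)\<^sup>2" .
qed simp

section \<open>The space \<open>H\<close>: linear structure, definiteness of the norm, and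
  scalars\<close>

locale l2_rkhs =
  fixes \<FF> :: "complex set" and M :: "'a measure" and H :: "('a \<Rightarrow> complex) set"
  assumes scalars: "\<FF> = \<real> \<or> \<FF> = UNIV"
    and rkhs: "rkhs_in_L2 \<FF> M H"
begin

lemma square_integrable: "f \<in> H \<Longrightarrow> square_integrable M f"
  using rkhs by (auto simp: rkhs_in_L2_def)

lemma of_real_in_scalars: "of_real t \<in> \<FF>"
  using scalars by auto

lemma lincomb_closed:
  assumes "f \<in> H" "g \<in> H" "a \<in> \<FF>" "b \<in> \<FF>"
  shows "(\<lambda>x. a * f x + b * g x) \<in> H"
proof -
  have "(\<lambda>x. a * f x) \<in> H" "(\<lambda>x. b * g x) \<in> H"
    using assms rkhs unfolding rkhs_in_L2_def by blast+
  moreover have "(\<lambda>x. u x + v x) \<in> H" if "u \<in> H" "v \<in> H" for u v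
    using rkhs that by (simp add: rkhs_in_L2_def)
  ultimately show ?thesis by simp
qed

lemma diff_closed: "f \<in> H \<Longrightarrow> g \<in> H \<Longrightarrow> (\<lambda>x. f x - g x) \<in> H"
  using lincomb_closed[of f g 1 "-1"] of_real_in_scalars[of 1] of_real_in_scalars[of "-1"] by simp

text \<open>Outside \<open>space M\<close> all elements of \<open>H\<close> vanish, so the bound 0
  works there. Covering every point spares later arguments a case distinction.\<close>

lemma eval_bounded: "\<exists>B. \<forall>f\<in>H. cmod (f x) \<le> B * l2_norm M f"
proof (cases "x \<in> space M")
  case True
  then show ?thesis using rkhs by (simp add: rkhs_in_L2_def)
next
  case False
  then have "\<forall>f\<in>H. f x = 0" using rkhs by (auto simp: rkhs_in_L2_def fun_space_def)
  then show ?thesis by (intro exI[of _ 0]) simp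
qed

text \<open>Elements of \<open>H\<close> are functions, not classes modulo null sets; the bounded
  point evaluations force a function of norm 0 to vanish at every point.\<close>

lemma l2_norm_eq_0: "f \<in> H \<Longrightarrow> l2_norm M f = 0 \<Longrightarrow> f = (\<lambda>_. 0)"
  using eval_bounded by (metis ext mult_zero_right norm_le_zero_iff)

lemma l2_inner_in_scalars:
  assumes "f \<in> H" "\<And>x. x \<in> space M \<Longrightarrow> g x \<in> \<FF>"
  shows "l2_inner M f g \<in> \<FF>"
proof (cases "\<FF> = UNIV")
  case False
  then have F: "\<FF> = \<real>" using scalars by simp
  have "l2_inner M f g = (\<integral>x. of_real (Re (f x) * Re (g x)) \<partial>M)"
    unfolding l2_inner_def
  proof (rule Bochner_Integration.integral_cong)
    fix x assume x: "x \<in> space M"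
    then have "f x \<in> \<real>" "g x \<in> \<real>"
      using assms rkhs F by (auto simp: rkhs_in_L2_def fun_space_def)
    then show "f x * cnj (g x) = of_real (Re (f x) * Re (g x))"
      by (auto elim!: Reals_cases)
  qed simp
  then show ?thesis using F by (simp only: integral_complex_of_real Reals_of_real)
qed simp

section \<open>Completeness and the Riesz representation theorem\<close>

lemma Metric_space_l2: "Metric_space H (\<lambda>f g. l2_norm M (\<lambda>x. f x - g x))"
proof
  fix f g assume "f \<in> H" "g \<in> H"
  show "l2_norm M (\<lambda>x. f x - g x) = 0 \<longleftrightarrow> f = g"
  proof
    assume "l2_norm M (\<lambda>x. f x - g x) = 0"
    with diff_closed[OF \<open>f \<in> H\<close> \<open>g \<in> H\<close>] have "(\<lambda>x. f x - g x) = (\<lambda>_. 0)"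
      by (rule l2_norm_eq_0)
    then show "f = g" by (simp add: fun_eq_iff)
  qed (simp add: l2_norm_def)
qed (simp, rule l2_norm_minus_commute, simp add: l2_norm_triangle square_integrable)

lemma Cauchy_sequence_converges:
  assumes "\<And>n. s n \<in> H"
    and "\<And>e. e > 0 \<Longrightarrow> \<exists>N. \<forall>m\<ge>N. \<forall>n\<ge>N. l2_norm M (\<lambda>x. s m x - s n x) < e"
  obtains k where "k \<in> H" "(\<lambda>n. l2_norm M (\<lambda>x. s n x - k x)) \<longlonglongrightarrow> 0"
proof -
  interpret Metric_space H "\<lambda>f g. l2_norm M (\<lambda>x. f x - g x)" by (rule Metric_space_l2)
  have "mcomplete" using rkhs by (simp add: rkhs_in_L2_def)
  moreover have "MCauchy s" unfolding MCauchy_def using assms by blast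
  ultimately obtain k where "limitin mtopology s k sequentially" unfolding mcomplete_def by blast
  then have k: "k \<in> H" and lim: "\<And>e. e > 0 \<Longrightarrow> \<exists>N. \<forall>n\<ge>N. l2_norm M (\<lambda>x. s n x - k x) < e"
    unfolding limit_metric_sequentially by blast+
  have "(\<lambda>n. l2_norm M (\<lambda>x. s n x - k x)) \<longlonglongrightarrow> 0"
    by (rule LIMSEQ_I) (use lim in auto)
  with k show ?thesis by (rule that)
qed

text \<open>
  The representing element minimizes \<open>\<parallel>f\<parallel>\<^sup>2 - 2 Re (L f)\<close>. The parallelogram law makes minimizing
  sequences Cauchy; the variational inequality passes to the limit.
\<close>

lemma Re_functional_representation:
  assumes bounded: "\<And>f. f \<in> H \<Longrightarrow> \<bar>L f\<bar> \<le> B * l2_norm M f"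
    and linear: "\<And>f g s t. f \<in> H \<Longrightarrow> g \<in> H \<Longrightarrow>
      L (\<lambda>x. complex_of_real s * f x + complex_of_real t * g x) = s * L f + t * L g"
  shows "\<exists>k\<in>H. \<forall>f\<in>H. L f = Re (l2_inner M f k)"
proof -
  define J where "J f = (l2_norm M f)\<^sup>2 - 2 * L f" for f
  have J_comb: "J (\<lambda>x. complex_of_real s * f x + complex_of_real t * g x)
      = s\<^sup>2 * (l2_norm M f)\<^sup>2 + 2 * s * t * Re (l2_inner M f g) + t\<^sup>2 * (l2_norm M g)\<^sup>2
        - 2 * s * L f - 2 * t * L g"
    if "f \<in> H" "g \<in> H" for f g s t
    unfolding J_def linear[OF that] l2_norm_sq_lincomb[OF that[THEN square_integrable]]
    by (simp add: algebra_simps)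
  have J_lower: "- B\<^sup>2 \<le> J f" if "f \<in> H" for f
  proof -
    \<comment> \<open>Completing the square: the bound on \<open>L\<close> gives
      \<open>J f \<ge> (l2_norm M f - B)\<^sup>2 - B\<^sup>2\<close>.\<close>
    have "0 \<le> (l2_norm M f - B)\<^sup>2" by simp
    then show ?thesis using bounded[OF that] by (simp add: J_def power2_diff algebra_simps)
  qed
  define m where "m = Inf (J ` H)"
  have bdd: "bdd_below (J ` H)" using J_lower by (auto intro!: bdd_belowI[of _ "- B\<^sup>2"])
  have m_le: "m \<le> J f" if "f \<in> H" for f
    unfolding m_def using bdd that by (intro cInf_lower) auto
  have "\<exists>f\<in>H. J f < m + 1 / real (Suc n)" for n
  proof -
    have "J ` H \<noteq> {}" using rkhs by (auto simp: rkhs_in_L2_def)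
    then have "\<exists>y\<in>J ` H. y < m + 1 / real (Suc n)"
      using cInf_lessD[of "J ` H" "m + 1 / real (Suc n)"] unfolding m_def by auto
    then show ?thesis by auto
  qed
  then obtain s where s: "\<And>n. s n \<in> H" and Js: "\<And>n. J (s n) < m + 1 / real (Suc n)"
    by metis
  have parallelogram: "(l2_norm M (\<lambda>x. f x - g x))\<^sup>2 \<le> 2 * (J f - m) + 2 * (J g - m)"
    if "f \<in> H" "g \<in> H" for f g
  proof -
    \<comment> \<open>The squared distance of \<open>f\<close> and \<open>g\<close> equals
      \<open>2 * J f + 2 * J g\<close> minus four times the value of \<open>J\<close> at the
      midpoint, and that value is at least \<open>m\<close>.\<close>
    have "(\<lambda>x. complex_of_real (1/2) * f x + complex_of_real (1/2) * g x) \<in> H"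
      using that by (intro lincomb_closed of_real_in_scalars)
    then have "m \<le> J (\<lambda>x. complex_of_real (1/2) * f x + complex_of_real (1/2) * g x)"
      by (rule m_le)
    moreover have "(l2_norm M (\<lambda>x. f x - g x))\<^sup>2
        = (l2_norm M f)\<^sup>2 - 2 * Re (l2_inner M f g) + (l2_norm M g)\<^sup>2"
      using l2_norm_sq_lincomb[OF that[THEN square_integrable], of 1 "-1"] by simp
    ultimately show ?thesis
      unfolding J_comb[OF that] by (simp add: J_def power2_eq_square)
  qed
  have Cauchy: "\<exists>N. \<forall>i\<ge>N. \<forall>j\<ge>N. l2_norm M (\<lambda>x. s i x - s j x) < e" if "e > 0" for e
  proof -
    \<comment> \<open>Two excesses over \<open>m\<close>, each below \<open>e\<^sup>2 / 4\<close>
      and each doubled by the parallelogram bound, add up to less than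
      \<open>e\<^sup>2\<close>.\<close>
    obtain N where N: "1 / real (Suc N) < e\<^sup>2 / 4"
      using reals_Archimedean[of "e\<^sup>2 / 4"] \<open>e > 0\<close> by (auto simp: inverse_eq_divide)
    have "l2_norm M (\<lambda>x. s i x - s j x) < e" if "i \<ge> N" "j \<ge> N" for i j
    proof (rule power2_less_imp_less)
      have J_less: "J (s n) - m < e\<^sup>2 / 4" if "n \<ge> N" for n
      proof -
        have "1 / real (Suc n) \<le> 1 / real (Suc N)" using that by (simp add: frac_le)
        then show ?thesis using Js[of n] N by argo
      qed
      have "(l2_norm M (\<lambda>x. s i x - s j x))\<^sup>2 \<le> 2 * (J (s i) - m) + 2 * (J (s j) - m)"
        by (rule parallelogram[OF s s])
      also have "\<dots> < e\<^sup>2"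
        using J_less[OF \<open>i \<ge> N\<close>] J_less[OF \<open>j \<ge> N\<close>] by (simp add: field_simps)
      finally show "(l2_norm M (\<lambda>x. s i x - s j x))\<^sup>2 < e\<^sup>2" .
    qed (use \<open>e > 0\<close> in simp)
    then show ?thesis by blast
  qed
  obtain k where k: "k \<in> H" and lim: "(\<lambda>n. l2_norm M (\<lambda>x. s n x - k x)) \<longlonglongrightarrow> 0"
    by (rule Cauchy_sequence_converges[OF s Cauchy])
  have "L f = Re (l2_inner M f k)" if f: "f \<in> H" for f
  proof -
    let ?d = "\<lambda>n. Re (l2_inner M f (s n)) - L f"
    \<comment> \<open>Moving from \<open>s n\<close> along \<open>f\<close> lowers \<open>J\<close>
      by no more than the excess \<open>J (s n) - m\<close>, which is below
      \<open>1 / (n + 1)\<close>. The resulting quadratic in \<open>t\<close> is nonnegative, and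
      its discriminant bounds \<open>?d n\<close>.\<close>
    have "(?d n)\<^sup>2 \<le> (l2_norm M f)\<^sup>2 * (1 / real (Suc n))" for n
    proof (rule linear_coeff_bound)
      fix t :: real
      have "(\<lambda>x. complex_of_real t * f x + complex_of_real 1 * s n x) \<in> H"
        using f s by (intro lincomb_closed of_real_in_scalars)
      then have "m \<le> J (\<lambda>x. complex_of_real t * f x + complex_of_real 1 * s n x)"
        by (rule m_le)
      then show "0 \<le> (l2_norm M f)\<^sup>2 * t\<^sup>2 + 2 * ?d n * t + 1 / real (Suc n)"
        unfolding J_comb[OF f s] using Js[of n] by (simp add: J_def algebra_simps)
    qed
    then have "\<forall>n. norm ((?d n)\<^sup>2) \<le> (l2_norm M f)\<^sup>2 * (1 / real (Suc n))" by simp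
    moreover have "(\<lambda>n. (l2_norm M f)\<^sup>2 * (1 / real (Suc n))) \<longlonglongrightarrow> 0"
      by (intro tendsto_mult_right_zero LIMSEQ_Suc[OF lim_1_over_n])
    ultimately have "(\<lambda>n. (?d n)\<^sup>2) \<longlonglongrightarrow> 0"
      by (rule Lim_null_comparison[OF always_eventually])
    then have "(\<lambda>n. sqrt ((?d n)\<^sup>2)) \<longlonglongrightarrow> sqrt 0" by (rule tendsto_real_sqrt)
    then have "?d \<longlonglongrightarrow> 0" by (simp add: tendsto_rabs_zero_iff)
    then have lim_L: "(\<lambda>n. Re (l2_inner M f (s n))) \<longlonglongrightarrow> L f" by (simp add: LIM_zero_iff)
    have "\<forall>n. norm (Re (l2_inner M f (s n)) - Re (l2_inner M f k))
        \<le> l2_norm M f * l2_norm M (\<lambda>x. s n x - k x)"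
      using Re_l2_inner_bound[of M f "\<lambda>x. s n x - k x" for n] f k s
      by (simp add: l2_inner_diff_right square_integrable square_integrable_diff)
    moreover have "(\<lambda>n. l2_norm M f * l2_norm M (\<lambda>x. s n x - k x)) \<longlonglongrightarrow> 0"
      using tendsto_mult_right_zero[OF lim] .
    ultimately have "(\<lambda>n. Re (l2_inner M f (s n)) - Re (l2_inner M f k)) \<longlonglongrightarrow> 0"
      by (rule Lim_null_comparison[OF always_eventually])
    then have "(\<lambda>n. Re (l2_inner M f (s n))) \<longlonglongrightarrow> Re (l2_inner M f k)"
      by (simp add: LIM_zero_iff)
    with lim_L show ?thesis by (rule LIMSEQ_unique)
  qed
  with k show ?thesis by blast
qed

text \<open>A linear functional is determined by its real part: over the complex numbers by testing
  also with \<open>\<i> * f\<close>, over the reals because all values are real.\<close>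

lemma functional_representation:
  assumes bounded: "\<And>f. f \<in> H \<Longrightarrow> \<bar>Re (L f)\<bar> \<le> B * l2_norm M f"
    and range: "\<And>f. f \<in> H \<Longrightarrow> L f \<in> \<FF>"
    and linear: "\<And>f g a b. f \<in> H \<Longrightarrow> g \<in> H \<Longrightarrow> L (\<lambda>x. a * f x + b * g x) = a * L f + b * L g"
  shows "\<exists>k\<in>H. \<forall>f\<in>H. L f = l2_inner M f k"
proof -
  have "\<exists>k\<in>H. \<forall>f\<in>H. Re (L f) = Re (l2_inner M f k)"
    by (rule Re_functional_representation[of "\<lambda>f. Re (L f)", OF bounded])
      (simp_all add: linear)
  then obtain k where k: "k \<in> H" and eq: "\<And>f. f \<in> H \<Longrightarrow> Re (L f) = Re (l2_inner M f k)"
    by blast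
  have "L f = l2_inner M f k" if f: "f \<in> H" for f
  proof (cases "\<FF> = UNIV")
    case True
    \<comment> \<open>Testing with \<open>\<i> * f\<close> turns real parts into negated imaginary
      parts; the summand \<open>0 * f x\<close> only gives the combination the shape required by
      linearity.\<close>
    then have if_H: "(\<lambda>x. \<i> * f x + 0 * f x) \<in> H" using f by (intro lincomb_closed) auto
    show ?thesis
      using eq[OF f] eq[OF if_H] f k
      unfolding linear[OF f f] l2_inner_lincomb_left[OF f[THEN square_integrable] f[THEN square_integrable] k[THEN square_integrable]]
      by (simp add: complex_eq_iff)
  next
    case False
    then have F: "\<FF> = \<real>" using scalars by simp
    have "k x \<in> \<FF>" if "x \<in> space M" for x
      using k that rkhs by (auto simp: rkhs_in_L2_def fun_space_def)
    then have "l2_inner M f k \<in> \<real>" using l2_inner_in_scalars[OF f] F by blast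
    moreover have "L f \<in> \<real>" using range[OF f] F by simp
    ultimately show ?thesis using eq[OF f] by (simp add: complex_eq_iff complex_is_Real_iff)
  qed
  with k show ?thesis by blast
qed

section \<open>The reproducing kernel and the orthogonal projection\<close>

text \<open>This justifies the definite description in \<open>kernel_fun\<close>. Existence is the
  representation of point evaluation at \<open>x\<close>; uniqueness holds because the difference of
  two candidates is orthogonal to itself.\<close>

lemma kernel_fun:
  shows kernel_fun_in: "kernel_fun M H x \<in> H"
    and kernel_fun_reproducing: "f \<in> H \<Longrightarrow> l2_inner M f (kernel_fun M H x) = f x"
proof -
  obtain B where B: "\<And>f. f \<in> H \<Longrightarrow> cmod (f x) \<le> B * l2_norm M f"
    using eval_bounded by blast
  have "\<exists>k\<in>H. \<forall>f\<in>H. f x = l2_inner M f k"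
  proof (rule functional_representation[where L = "\<lambda>f. f x"])
    show "\<bar>Re (f x)\<bar> \<le> B * l2_norm M f" if "f \<in> H" for f
      using B[OF that] abs_Re_le_cmod[of "f x"] by linarith
    show "f x \<in> \<FF>" if "f \<in> H" for f
      using that rkhs of_real_in_scalars[of 0]
      by (cases "x \<in> space M") (auto simp: rkhs_in_L2_def fun_space_def)
  qed simp
  moreover have "k = k'" if k: "k \<in> H" "k' \<in> H"
    and eq: "\<forall>f\<in>H. f x = l2_inner M f k" "\<forall>f\<in>H. f x = l2_inner M f k'" for k k'
  proof -
    let ?d = "\<lambda>x. k x - k' x"
    have d: "?d \<in> H" using diff_closed[OF k] .
    have "l2_inner M ?d ?d = l2_inner M ?d k - l2_inner M ?d k'"
      using k d by (intro l2_inner_diff_right square_integrable)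
    also have "\<dots> = 0" using eq d by simp
    finally have "?d = (\<lambda>_. 0)" using l2_norm_eq_0[OF d] by (simp add: l2_inner_self)
    then show ?thesis by (simp add: fun_eq_iff)
  qed
  ultimately have "\<exists>!k. k \<in> H \<and> (\<forall>f\<in>H. f x = l2_inner M f k)" by blast
  from theI'[OF this, folded kernel_fun_def]
  show "kernel_fun M H x \<in> H" "f \<in> H \<Longrightarrow> l2_inner M f (kernel_fun M H x) = f x" by simp_all
qed

text \<open>By the reproducing property and conjugate symmetry, the kernel at \<open>x\<close>,
  \<open>y\<close> is the conjugate of \<open>kernel_fun M H x\<close> at \<open>y\<close>.\<close>

lemma kernel_op_eq_inner: "kernel_op M H G x = l2_inner M G (kernel_fun M H x)"
proof -
  have "rkernel M H x y = cnj (kernel_fun M H x y)" for y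
    unfolding rkernel_def
    using kernel_fun_reproducing[OF kernel_fun_in] l2_inner_commute by metis
  then show ?thesis by (simp add: kernel_op_def l2_inner_def)
qed

lemma kernel_op_fixes: "f \<in> H \<Longrightarrow> kernel_op M H f = f"
  by (simp add: kernel_op_eq_inner kernel_fun_reproducing fun_eq_iff)

text \<open>The projection of \<open>G\<close> is the representer \<open>k\<close> of the functional
  \<open>l2_inner M f G\<close> in \<open>f\<close>. Pairing with \<open>kernel_fun M H x\<close>
  shows that \<open>kernel_op M H G\<close> and \<open>k\<close> agree at every \<open>x\<close>, so
  membership in \<open>H\<close> carries square integrability along.\<close>

lemma kernel_op_projection:
  assumes G: "square_integrable M G" "\<And>x. x \<in> space M \<Longrightarrow> G x \<in> \<FF>"
  shows kernel_op_in: "kernel_op M H G \<in> H"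
    and kernel_op_inner: "f \<in> H \<Longrightarrow> l2_inner M f (kernel_op M H G) = l2_inner M f G"
proof -
  have "\<exists>k\<in>H. \<forall>f\<in>H. l2_inner M f G = l2_inner M f k"
  proof (rule functional_representation[where L = "\<lambda>f. l2_inner M f G"])
    show "\<bar>Re (l2_inner M f G)\<bar> \<le> l2_norm M G * l2_norm M f" if "f \<in> H" for f
      using Re_l2_inner_bound[OF square_integrable[OF that] G(1)] by (simp add: mult.commute)
  qed (use G in \<open>auto intro!: l2_inner_in_scalars l2_inner_lincomb_left square_integrable\<close>)
  then obtain k where k: "k \<in> H" "\<And>f. f \<in> H \<Longrightarrow> l2_inner M f G = l2_inner M f k" by blast
  have "kernel_op M H G x = k x" for x
  proof -
    have "kernel_op M H G x = cnj (l2_inner M (kernel_fun M H x) k)"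
      by (simp add: kernel_op_eq_inner l2_inner_commute[of M G] k(2) kernel_fun_in)
    also have "\<dots> = k x"
      by (simp add: l2_inner_commute[symmetric] kernel_fun_reproducing k(1))
    finally show ?thesis .
  qed
  then have "kernel_op M H G = k" by (simp add: fun_eq_iff)
  then show "kernel_op M H G \<in> H" "f \<in> H \<Longrightarrow> l2_inner M f (kernel_op M H G) = l2_inner M f G"
    using k by simp_all
qed

section \<open>The stability inequality tested on the competitor \<open>G\<close>\<close>

text \<open>Cheeger quotient estimate without the division. Stability contributes the factor
  \<open>C\<^sup>2\<close>; the summand 1 is the commutator norm restored by Pythagoras.\<close>

lemma stability_le_commutator:
  assumes F: "F \<in> H" and S: "S \<in> sets M" and C: "C > 0"
    and stable: "\<And>G. G \<in> H \<Longrightarrow> (INF \<alpha>\<in>unit_scalars \<FF>. l2_norm M (\<lambda>x. F x - \<alpha> * G x))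
                \<le> C * l2_norm M (\<lambda>x. complex_of_real (cmod (F x) - cmod (G x)))"
  shows "min ((l2_norm M (restr S F))\<^sup>2) ((l2_norm M (restr (space M - S) F))\<^sup>2)
    \<le> (1 + C\<^sup>2) * (l2_norm M (commutator (kernel_op M H) (restr S) F))\<^sup>2"
proof -
  define F1 F2 where "F1 = restr S F" and "F2 = restr (space M - S) F"
  define A where "A = kernel_op M H F1"
  define B where "B = (\<lambda>x. F x - A x)"
  define E where "E = commutator (kernel_op M H) (restr S) F"
  define G where "G = (\<lambda>x. A x - B x)"
  have FM: "F x \<in> \<FF>" if "x \<in> space M" for x
    using F that rkhs by (auto simp: rkhs_in_L2_def fun_space_def)
  have F0: "F x = 0" if "x \<notin> space M" for x
    using F that rkhs by (auto simp: rkhs_in_L2_def fun_space_def)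
  have SM: "S \<subseteq> space M" using S by (rule sets.sets_into_space)
  have sqF1: "square_integrable M F1"
    using S square_integrable[OF F] by (simp add: F1_def square_integrable_restr)
  have F1M: "F1 x \<in> \<FF>" if "x \<in> space M" for x
    using FM[OF that] of_real_in_scalars[of 0] by (simp add: F1_def restr_def indicator_def)
  have A: "A \<in> H" unfolding A_def using sqF1 F1M by (rule kernel_op_in)
  have inner_A: "l2_inner M f A = l2_inner M f F1" if "f \<in> H" for f
    unfolding A_def using sqF1 F1M that by (rule kernel_op_inner)
  have B: "B \<in> H" unfolding B_def by (rule diff_closed[OF F A])
  have G: "G \<in> H" unfolding G_def by (rule diff_closed[OF A B])
  \<comment> \<open>The second term of the commutator is \<open>P_S F\<close>, since the projection
    fixes \<open>F\<close>.\<close>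
  have E_eq: "E = (\<lambda>x. A x - F1 x)"
    by (simp add: E_def commutator_def kernel_op_fixes[OF F] A_def F1_def)
  have sqA: "square_integrable M A" and sqB: "square_integrable M B"
    using A B by (simp_all add: square_integrable)
  have sqE: "square_integrable M E" unfolding E_eq by (rule square_integrable_diff[OF sqA sqF1])
  have orth: "l2_inner M f E = 0" if "f \<in> H" for f
    unfolding E_eq using inner_A[OF that] sqA sqF1 square_integrable[OF that]
    by (simp add: l2_inner_diff_right)
  have F_split: "F x = F1 x + F2 x" for x
    using F0[of x] by (auto simp: F1_def F2_def restr_def indicator_def)
  have "F1 = (\<lambda>x. 1 * A x + (-1) * E x)" by (simp add: E_eq)
  then have norm_F1: "(l2_norm M F1)\<^sup>2 = (l2_norm M A)\<^sup>2 + (l2_norm M E)\<^sup>2"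
    using l2_norm_sq_lincomb[OF sqA sqE, of 1 "-1"] orth[OF A] by simp
  have "F2 = (\<lambda>x. 1 * B x + 1 * E x)" using F_split by (simp add: E_eq B_def fun_eq_iff)
  then have norm_F2: "(l2_norm M F2)\<^sup>2 = (l2_norm M B)\<^sup>2 + (l2_norm M E)\<^sup>2"
    using l2_norm_sq_lincomb[OF sqB sqE, of 1 1] orth[OF B] by simp

  \<comment> \<open>The inner product of \<open>F\<close> and \<open>F1\<close> is the squared norm
    of \<open>F1\<close>, because the two functions agree wherever \<open>F1\<close> is nonzero;
    subtracting the squared norm of \<open>A\<close> keeps the value real.\<close>
  have AB_real: "Im (l2_inner M A B) = 0"
  proof -
    have "l2_inner M A F = cnj (l2_inner M F F1)"
      using l2_inner_commute[of M A F] inner_A[OF F] by simp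
    also have "l2_inner M F F1 = l2_inner M F1 F1"
      unfolding l2_inner_def
      by (rule Bochner_Integration.integral_cong) (simp_all add: F1_def restr_def indicator_def)
    finally have "Im (l2_inner M A F) = 0" by (simp add: l2_inner_self)
    moreover have "l2_inner M A B = l2_inner M A F - l2_inner M A A"
      unfolding B_def using A F by (simp add: l2_inner_diff_right square_integrable)
    ultimately show ?thesis by (simp add: l2_inner_self)
  qed
  define m where "m = min ((l2_norm M A)\<^sup>2) ((l2_norm M B)\<^sup>2)"
  have m0: "0 \<le> m" by (simp add: m_def)
  have dist: "2 * sqrt m \<le> l2_norm M (\<lambda>x. F x - \<alpha> * G x)" if "\<alpha> \<in> unit_scalars \<FF>" for \<alpha>
  proof (rule power2_le_imp_le)
    have unit: "(Re \<alpha>)\<^sup>2 + (Im \<alpha>)\<^sup>2 = 1"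
      using that cmod_power2[of \<alpha>] by (simp add: unit_scalars_def)
    have parts: "(cmod (1 - \<alpha>))\<^sup>2 + (cmod (1 + \<alpha>))\<^sup>2 = 4"
      using unit unfolding cmod_power2 by (simp add: power2_eq_square algebra_simps)
    \<comment> \<open>This real part is 1 minus the squared modulus of \<open>\<alpha>\<close>. A
      purely imaginary coefficient times a real inner product then kills the cross term.\<close>
    have "Re ((1 - \<alpha>) * cnj (1 + \<alpha>)) = 0"
      using unit by (simp add: power2_eq_square algebra_simps)
    then have cross: "Re ((1 - \<alpha>) * cnj (1 + \<alpha>) * l2_inner M A B) = 0"
      using AB_real by (subst times_complex.sel(1)) (simp only: mult_zero_left mult_zero_right diff_zero)
    have "(2 * sqrt m)\<^sup>2 = (cmod (1 - \<alpha>))\<^sup>2 * m + (cmod (1 + \<alpha>))\<^sup>2 * m"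
      using m0 parts by (simp add: power_mult_distrib flip: distrib_right)
    also have "\<dots> \<le> (cmod (1 - \<alpha>))\<^sup>2 * (l2_norm M A)\<^sup>2 + (cmod (1 + \<alpha>))\<^sup>2 * (l2_norm M B)\<^sup>2"
      by (intro add_mono mult_left_mono) (auto simp: m_def)
    also have "\<dots> = (l2_norm M (\<lambda>x. (1 - \<alpha>) * A x + (1 + \<alpha>) * B x))\<^sup>2"
      unfolding l2_norm_sq_lincomb[OF sqA sqB] cross by simp
    also have "(\<lambda>x. (1 - \<alpha>) * A x + (1 + \<alpha>) * B x) = (\<lambda>x. F x - \<alpha> * G x)"
      by (simp add: G_def B_def fun_eq_iff algebra_simps)
    finally show "(2 * sqrt m)\<^sup>2 \<le> (l2_norm M (\<lambda>x. F x - \<alpha> * G x))\<^sup>2" .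
  qed simp
  \<comment> \<open>A lower bound passes to a real-valued infimum only over a nonempty index
    set.\<close>
  have "1 \<in> unit_scalars \<FF>" using of_real_in_scalars[of 1] by (simp add: unit_scalars_def)
  then have "2 * sqrt m \<le> (INF \<alpha>\<in>unit_scalars \<FF>. l2_norm M (\<lambda>x. F x - \<alpha> * G x))"
    using dist by (intro cINF_greatest) auto
  also have "\<dots> \<le> C * l2_norm M (\<lambda>x. complex_of_real (cmod (F x) - cmod (G x)))"
    by (rule stable[OF G])
  also have "\<dots> \<le> C * (2 * l2_norm M E)"
  proof -
    have pointwise: "\<bar>cmod (F x) - cmod (G x)\<bar> \<le> 2 * cmod (E x)" for x
    proof -
      have "G x = (F1 x - F2 x) + 2 * E x"
        using F_split[of x] by (simp add: G_def B_def E_eq)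
      moreover have "cmod (F1 x - F2 x) = cmod (F x)"
        using F0[of x] SM by (auto simp: F1_def F2_def restr_def indicator_def)
      ultimately show ?thesis
        using norm_triangle_ineq3[of "F1 x - F2 x" "G x"] by (simp add: norm_mult)
    qed
    have intE: "integrable M (\<lambda>x. (2 * cmod (E x))\<^sup>2)"
      using sqE by (simp add: square_integrable_def power_mult_distrib)
    have "(\<integral>x. (cmod (complex_of_real (cmod (F x) - cmod (G x))))\<^sup>2 \<partial>M) \<le> (\<integral>x. (2 * cmod (E x))\<^sup>2 \<partial>M)"
      using intE
    proof (rule integral_mono')
      show "(cmod (complex_of_real (cmod (F x) - cmod (G x))))\<^sup>2 \<le> (2 * cmod (E x))\<^sup>2" for x
        using power_mono[OF pointwise[of x], of 2] unfolding norm_of_real by simp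
    qed simp
    also have "\<dots> = (2 * l2_norm M E)\<^sup>2"
      by (simp add: l2_norm_def power_mult_distrib)
    finally have "l2_norm M (\<lambda>x. complex_of_real (cmod (F x) - cmod (G x))) \<le> 2 * l2_norm M E"
      unfolding l2_norm_def[of M "\<lambda>x. complex_of_real (cmod (F x) - cmod (G x))"]
      by (rule real_le_lsqrt[rotated]) simp
    then show ?thesis using C by simp
  qed
  finally have "sqrt m \<le> C * l2_norm M E" by simp
  then have "m \<le> (C * l2_norm M E)\<^sup>2" by (rule sqrt_le_D)
  \<comment> \<open>By \<open>norm_F1\<close> and \<open>norm_F2\<close> the left-hand minimum is
    \<open>m\<close> plus the squared norm of \<open>E\<close>.\<close>
  then show ?thesis
    using norm_F1 norm_F2 unfolding m_def F1_def F2_def E_def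
    by (auto simp: power_mult_distrib algebra_simps min_def split: if_splits)
qed

end

section \<open>From a single admissible constant to the two infima\<close>

theorem theorem3p6:
  fixes \<FF> :: "complex set" and M :: "'a measure"
    and H :: "('a \<Rightarrow> complex) set" and F :: "'a \<Rightarrow> complex"
  assumes "\<FF> = \<real> \<or> \<FF> = UNIV"
    and "sigma_finite_measure M"
    and "rkhs_in_L2 \<FF> M H"
    and "(\<lambda>(x, y). rkernel M H x y) \<in> borel_measurable (M \<Otimes>\<^sub>M M)"
    and "F \<in> H"
    and "F \<noteq> (\<lambda>_. 0)"
    and "phase_retrievable \<FF> M H F"
  shows "local_stability_constant \<FF> M H F
           \<ge> esqrt (inverse (ereal (kernel_cheeger_constant M H F)) - 1)"
proof -
  interpret l2_rkhs \<FF> M H using assms by unfold_locales auto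
  let ?c = "kernel_cheeger_constant M H F"
  \<comment> \<open>Every admissible \<open>C\<close> is treated separately. If there is none, the
    infimum in the stability constant is \<open>\<infinity>\<close> and the bound is
    immediate.\<close>
  have "esqrt (inverse (ereal ?c) - 1) \<le> ereal C"
    if C: "C > 0" and stable: "\<forall>G\<in>H. (INF \<alpha>\<in>unit_scalars \<FF>. l2_norm M (\<lambda>x. F x - \<alpha> * G x))
                \<le> C * l2_norm M (\<lambda>x. complex_of_real (cmod (F x) - cmod (G x)))" for C
  proof -
    have pos: "0 < 1 + C\<^sup>2" by (simp add: add_pos_nonneg)
    have c: "1 / (1 + C\<^sup>2) \<le> ?c"
    proof (cases "separating_sets M F = {}")
      case True
      then show ?thesis using pos by (simp add: kernel_cheeger_constant_def)
    next
      case False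
      have "1 / (1 + C\<^sup>2) \<le> (l2_norm M (commutator (kernel_op M H) (restr S) F))\<^sup>2 /
          min ((l2_norm M (restr S F))\<^sup>2) ((l2_norm M (restr (space M - S) F))\<^sup>2)" (is "_ \<le> ?e / ?n")
        if S: "S \<in> separating_sets M F" for S
      proof -
        have "?n \<le> (1 + C\<^sup>2) * ?e"
          using stability_le_commutator[OF assms(5) _ C] stable S
          by (auto simp: separating_sets_def)
        moreover have "0 < ?n" using S by (simp add: separating_sets_def)
        ultimately show ?thesis using pos by (simp add: divide_simps mult.commute)
      qed
      then show ?thesis
        using False by (auto simp: kernel_cheeger_constant_def intro!: cINF_greatest)
    qed
    \<comment> \<open>A finite stability constant excludes Cheeger constant 0, so the extended
      inverse is finite and \<open>esqrt\<close> is the real square root here.\<close>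
    then have c0: "0 < ?c" using pos by (meson less_le_trans zero_less_divide_1_iff)
    have "1 / ?c - 1 \<le> C\<^sup>2" using c c0 pos by (simp add: field_simps)
    then have "sqrt (1 / ?c - 1) \<le> C" using C by (intro real_le_lsqrt) auto
    moreover have "inverse (ereal ?c) - 1 = ereal (1 / ?c - 1)"
      using c0 by (simp add: one_ereal_def inverse_eq_divide)
    ultimately show ?thesis by (simp add: esqrt_def)
  qed
  then show ?thesis
    unfolding local_stability_constant_def by (auto intro!: Inf_greatest)
qed

end
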